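(* Let $(X,\varrho)$ be a metric space and $(Y,\|\cdot\|)$ a Banach space. Let $F_i:X\to2^Y$, $i=1,2$, be set-valued mappings with closed convex images. Let $\omega_i:[0,+\infty)\to[0,+\infty)$, $i=1,2$, be a modulus of continuity for $F_i$, i.e. $\lim_{t\to+0}\omega_i(t)=0$ and $$h(F_i(x_1),F_i(x_2))\le\omega_i(\varrho(x_1,x_2))\qquad\text{for all }x_1,x_2\in X,\ i=1,2.$$ Let $d(x)=\min_{1\le i\le2}\operatorname{diam}F_i(x)<+\infty$ for all $x\in X$. Suppose there exist a function $\gamma:X\to[0,+\infty)$ and a number $\alpha>0$ such that $$\gamma(x)B^Y_1(0)\subset F_1(x)-F_2(x)\quad\text{and}\quad d(x)\le\alpha\gamma(x)\qquad\text{for all }x\in X.$$ Then the set-valued mapping $G(x)=F_1(x)\cap F_2(x)$ is uniformly continuous with the modulus $\omega(t)=\max\{\omega_1(t),\omega_2(t)\}+\alpha(\omega_1(t)+\omega_2(t))$, i.e. $h(G(x_1),G(x_2))\le\omega(\varrho(x_1,x_2))$ for all $x_1,x_2\in X$.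
   Context: Images $F_i(x)$ are nonempty. $B^Y_r(y)=\{z\in Y:\|y-z\|\le r\}$. $A-B=\{a-b:a\in A,\ b\in B\}$. $h$ is the Hausdorff distance, $h(A,B)=\inf\{h>0 : A\subset B+B^Y_h(0),\ B\subset A+B^Y_h(0)\}$ (the same formula is used for unbounded closed sets). *)

theory Defs
  imports "HOL-Analysis.Analysis"
begin

text \<open>
  On sets, \<open>+\<close> is the elementwise (Minkowski) sum, but \<open>-\<close> is
  the set-theoretic difference, so the elementwise difference needs a constant of its own.
\<close>

definition minkowski_diff :: "'a::minus set \<Rightarrow> 'a set \<Rightarrow> 'a set" where
  "minkowski_diff A B = {a - b | a b. a \<in> A \<and> b \<in> B}"

text \<open>
  Hausdorff distance and diameter take extended values, because the sets involved may be
  unbounded: the infimum of the empty set of radii is \<open>\<infinity>\<close> here, whereas in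
  \<^typ>\<open>real\<close> it would be an unspecified number.
\<close>

definition hausdorff_dist :: "'a::real_normed_vector set \<Rightarrow> 'a set \<Rightarrow> ennreal" where
  "hausdorff_dist A B =
     Inf {ennreal r | r. 0 < r \<and> A \<subseteq> B + cball 0 r \<and> B \<subseteq> A + cball 0 r}"

definition ediam :: "'a::metric_space set \<Rightarrow> ennreal" where
  "ediam A = (SUP a\<in>A. SUP b\<in>A. ennreal (dist a b))"

text \<open>
  A modulus is a function \<open>[0, \<infinity>) \<rightarrow> [0, \<infinity>)\<close>, encoded
  as a function on \<^typ>\<open>real\<close> whose values at negative arguments are irrelevant. Its
  value at \<open>0\<close> is not required to be \<open>0\<close>.
\<close>

definition modulus_of_continuity ::
  "(real \<Rightarrow> real) \<Rightarrow> ('x::metric_space \<Rightarrow> 'y::real_normed_vector set) \<Rightarrow> bool" where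
  "modulus_of_continuity \<omega> F \<longleftrightarrow>
     (\<forall>t\<ge>0. 0 \<le> \<omega> t) \<and>
     (\<omega> \<longlongrightarrow> 0) (at_right 0) \<and>
     (\<forall>x1 x2. hausdorff_dist (F x1) (F x2) \<le> ennreal (\<omega> (dist x1 x2)))"

end

theory Submission
  imports Defs
begin

text \<open>
  Write \<open>A\<^sub>i = F\<^sub>i x\<^sub>2\<close> and let \<open>y \<in> G x\<^sub>1\<close>. For all radii \<open>r\<^sub>i\<close> above
  \<open>\<omega>\<^sub>i (dist x\<^sub>1 x\<^sub>2)\<close> there are \<open>f\<^sub>i \<in> A\<^sub>i\<close> within \<open>r\<^sub>i\<close> of \<open>y\<close>. These two points may differ,
  but only by \<open>s = r\<^sub>1 + r\<^sub>2\<close>. The ball of radius \<open>\<gamma> = \<gamma> x\<^sub>2\<close> inside \<open>A\<^sub>1 - A\<^sub>2\<close> closes this gap: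
  it supplies \<open>u \<in> A\<^sub>1\<close> and \<open>v \<in> A\<^sub>2\<close> whose difference points opposite to \<open>f\<^sub>1 - f\<^sub>2\<close> and is rescaled
  so that moving both \<open>f\<^sub>1\<close> towards \<open>u\<close> and \<open>f\<^sub>2\<close> towards \<open>v\<close> by the fraction \<open>s / (\<gamma> + s)\<close>
  leads to the same point \<open>z\<close>. By convexity \<open>z \<in> A\<^sub>1 \<inter> A\<^sub>2\<close>. The move costs at most
  \<open>s / (\<gamma> + s)\<close> times the diameter of whichever \<open>A\<^sub>i\<close> is the smaller one, so at most
  \<open>\<alpha> \<gamma> s / (\<gamma> + s) \<le> \<alpha> s\<close>, and hence
  \<open>dist y z \<le> max r\<^sub>1 r\<^sub>2 + \<alpha> (r\<^sub>1 + r\<^sub>2)\<close>; this is lemma \<open>intersection_point_near\<close>.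
  Letting the \<open>r\<^sub>i\<close> decrease to \<open>\<omega>\<^sub>i (dist x\<^sub>1 x\<^sub>2)\<close> and exchanging \<open>x\<^sub>1\<close> and \<open>x\<^sub>2\<close> gives the
  modulus.
\<close>

lemma dist_le_if_ediam_le:
  assumes "ediam A \<le> ennreal c" "0 \<le> c" "a \<in> A" "b \<in> A"
  shows "dist a b \<le> c"
proof -
  have "ennreal (dist a b) \<le> ediam A"
    unfolding ediam_def using assms(3,4) by (meson SUP_upper2 order_refl)
  then show ?thesis
    using assms(1,2) by (meson ennreal_le_iff order_trans)
qed

lemma subset_plus_cball_iff:
  fixes A B :: "'a::real_normed_vector set"
  shows "A \<subseteq> B + cball 0 r \<longleftrightarrow> (\<forall>a\<in>A. \<exists>b\<in>B. dist a b \<le> r)"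
proof -
  have "a \<in> B + cball 0 r \<longleftrightarrow> (\<exists>b\<in>B. dist a b \<le> r)" for a
  proof
    assume "a \<in> B + cball 0 r"
    then obtain b c where "b \<in> B" "norm c \<le> r" "a = b + c"
      by (auto elim!: set_plus_elim)
    then show "\<exists>b\<in>B. dist a b \<le> r"
      by (intro bexI[of _ b]) (simp_all add: dist_norm)
  next
    assume "\<exists>b\<in>B. dist a b \<le> r"
    then obtain b where "b \<in> B" "a - b \<in> cball 0 r"
      by (auto simp: dist_norm norm_minus_commute)
    then have "b + (a - b) \<in> B + cball 0 r"
      by (rule set_plus_intro)
    then show "a \<in> B + cball 0 r"
      by simp
  qed
  then show ?thesis
    by blast
qed

text \<open>
  The infimum defining the Hausdorff distance need not be attained, so a radius strictly above
  the bound is required.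
\<close>

lemma point_near_if_hausdorff_dist_less:
  assumes "hausdorff_dist A B \<le> ennreal w" "0 \<le> w" "w < r" "a \<in> A"
  shows "\<exists>b\<in>B. dist a b \<le> r"
proof -
  have "hausdorff_dist A B < ennreal r"
    using assms(1-3) by (metis ennreal_lessI le_less_trans order.strict_trans1)
  then obtain r' where r': "0 < r'" "ennreal r' < ennreal r" "A \<subseteq> B + cball 0 r'"
    unfolding hausdorff_dist_def Inf_less_iff by blast
  then have "r' \<le> r"
    by (simp add: ennreal_less_iff)
  then show ?thesis
    using r'(3) assms(4) unfolding subset_plus_cball_iff by (meson order_trans)
qed

lemma hausdorff_dist_leI:
  assumes "0 < r"
    and "\<And>a. a \<in> A \<Longrightarrow> \<exists>b\<in>B. dist a b \<le> r" "\<And>b. b \<in> B \<Longrightarrow> \<exists>a\<in>A. dist b a \<le> r"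
  shows "hausdorff_dist A B \<le> ennreal r"
  unfolding hausdorff_dist_def
  by (rule Inf_lower) (use assms in \<open>auto simp: subset_plus_cball_iff\<close>)

text \<open>
  The quantitative core. The radii are assumed to have a positive sum so that the fraction
  \<open>s / (\<gamma> + s)\<close> makes sense even for \<open>\<gamma> = 0\<close>; in that degenerate case the fraction is \<open>1\<close> and
  \<open>z = u = v\<close> is an arbitrary common point, which is harmless because then one of the two sets is
  a singleton.
\<close>

lemma intersection_point_near:
  fixes A B :: "'a::real_normed_vector set"
  assumes "convex A" "convex B"
    and "0 \<le> \<gamma>" "0 \<le> \<alpha>"
    and ball: "(\<lambda>y. \<gamma> *\<^sub>R y) ` cball 0 1 \<subseteq> minkowski_diff A B"
    and diam: "min (ediam A) (ediam B) \<le> ennreal (\<alpha> * \<gamma>)"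
    and f: "f1 \<in> A" "f2 \<in> B" "dist y f1 \<le> r1" "dist y f2 \<le> r2"
    and "0 < r1 + r2"
  shows "\<exists>z\<in>A \<inter> B. dist y z \<le> max r1 r2 + \<alpha> * (r1 + r2)"
proof -
  define s where "s = r1 + r2"
  have s: "0 < s"
    using assms by (simp add: s_def)
  have "dist f1 f2 \<le> s"
    using dist_triangle2[of f1 f2 y] f by (simp add: s_def dist_commute)
  then have "(1 / s) *\<^sub>R (f2 - f1) \<in> cball 0 1"
    using s by (simp add: dist_norm norm_minus_commute)
  then have "\<gamma> *\<^sub>R ((1 / s) *\<^sub>R (f2 - f1)) \<in> minkowski_diff A B"
    using ball by blast
  then obtain u v where uv: "u \<in> A" "v \<in> B" "u - v = (\<gamma> / s) *\<^sub>R (f2 - f1)"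
    by (auto simp: minkowski_diff_def)
  define t where "t = s / (\<gamma> + s)"
  have t: "0 \<le> t" "t \<le> 1"
    using s \<open>0 \<le> \<gamma>\<close> by (auto simp: t_def)
  define z where "z = (1 - t) *\<^sub>R f1 + t *\<^sub>R u"
  have "t * (\<gamma> / s) = 1 - t"
    using s \<open>0 \<le> \<gamma>\<close> by (simp add: t_def field_simps)
  then have "t *\<^sub>R (u - v) = (1 - t) *\<^sub>R (f2 - f1)"
    unfolding uv(3) by simp
  then have z2: "z = (1 - t) *\<^sub>R f2 + t *\<^sub>R v"
    unfolding z_def by (simp add: algebra_simps)
  have "z \<in> A"
    unfolding z_def using assms(1) f(1) uv(1) t by (intro convexD) auto
  moreover have "z \<in> B"
    unfolding z2 using assms(2) f(2) uv(2) t by (intro convexD) auto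
  moreover have "dist y z \<le> max r1 r2 + \<alpha> * s"
  proof -
    have cost: "t * (\<alpha> * \<gamma>) \<le> \<alpha> * s"
    proof -
      have "t * \<gamma> \<le> s"
        using s \<open>0 \<le> \<gamma>\<close> by (simp add: t_def field_simps)
      then show ?thesis
        using mult_left_mono[OF _ \<open>0 \<le> \<alpha>\<close>] by (metis mult.left_commute)
    qed
    have step: "dist y z \<le> max r1 r2 + \<alpha> * s"
      if "ediam C \<le> ennreal (\<alpha> * \<gamma>)" "p \<in> C" "q \<in> C" "dist y p \<le> max r1 r2"
        "z = (1 - t) *\<^sub>R p + t *\<^sub>R q" for C p q
    proof -
      have "p - z = t *\<^sub>R (p - q)"
        unfolding that(5) by (simp add: algebra_simps)
      then have "dist p z = t * dist p q"
        using t by (simp add: dist_norm)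
      also have "\<dots> \<le> t * (\<alpha> * \<gamma>)"
        using dist_le_if_ediam_le[OF that(1) _ that(2,3)] t assms(3,4)
        by (intro mult_left_mono) auto
      finally show ?thesis
        using cost that(4) dist_triangle[of y z p] by linarith
    qed
    from diam consider "ediam A \<le> ennreal (\<alpha> * \<gamma>)" | "ediam B \<le> ennreal (\<alpha> * \<gamma>)"
      by (auto simp: min_le_iff_disj)
    then show ?thesis
    proof cases
      case 1
      show ?thesis
        by (rule step[OF 1 f(1) uv(1) _ z_def]) (use f in simp)
    next
      case 2
      show ?thesis
        by (rule step[OF 2 f(2) uv(2) _ z2]) (use f in simp)
    qed
  qed
  ultimately show ?thesis
    unfolding s_def by blast
qed

theorem theorem3p1:
  fixes F1 F2 :: "'x::metric_space \<Rightarrow> 'y::banach set"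
    and \<omega>1 \<omega>2 :: "real \<Rightarrow> real"
    and d :: "'x \<Rightarrow> ennreal"
    and \<gamma> :: "'x \<Rightarrow> real"
    and \<alpha> :: real
  assumes "\<And>x. F1 x \<noteq> {}" and "\<And>x. closed (F1 x)" and "\<And>x. convex (F1 x)"
    and "\<And>x. F2 x \<noteq> {}" and "\<And>x. closed (F2 x)" and "\<And>x. convex (F2 x)"
    and "modulus_of_continuity \<omega>1 F1"
    and "modulus_of_continuity \<omega>2 F2"
    and "\<And>x. d x = min (ediam (F1 x)) (ediam (F2 x))"
    and "\<And>x. d x < \<infinity>"
    and "\<And>x. 0 \<le> \<gamma> x"
    and "0 < \<alpha>"
    and "\<And>x. (\<lambda>y. \<gamma> x *\<^sub>R y) ` cball 0 1 \<subseteq> minkowski_diff (F1 x) (F2 x)"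
    and "\<And>x. d x \<le> ennreal (\<alpha> * \<gamma> x)"
  shows "(\<forall>x. F1 x \<inter> F2 x \<noteq> {}) \<and>
    modulus_of_continuity (\<lambda>t. max (\<omega>1 t) (\<omega>2 t) + \<alpha> * (\<omega>1 t + \<omega>2 t)) (\<lambda>x. F1 x \<inter> F2 x)"
proof (intro conjI allI)
  fix x
  have "0 \<in> minkowski_diff (F1 x) (F2 x)"
    using subsetD[OF assms(13)[of x] imageI[of 0]] by simp
  then show "F1 x \<inter> F2 x \<noteq> {}"
    by (auto simp: minkowski_diff_def)
next
  let ?\<omega> = "\<lambda>t. max (\<omega>1 t) (\<omega>2 t) + \<alpha> * (\<omega>1 t + \<omega>2 t)"
  have \<omega>: "\<And>t. 0 \<le> t \<Longrightarrow> 0 \<le> \<omega>1 t" "\<And>t. 0 \<le> t \<Longrightarrow> 0 \<le> \<omega>2 t"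
    "(\<omega>1 \<longlongrightarrow> 0) (at_right 0)" "(\<omega>2 \<longlongrightarrow> 0) (at_right 0)"
    and h: "\<And>x1 x2. hausdorff_dist (F1 x1) (F1 x2) \<le> ennreal (\<omega>1 (dist x1 x2))"
      "\<And>x1 x2. hausdorff_dist (F2 x1) (F2 x2) \<le> ennreal (\<omega>2 (dist x1 x2))"
    using assms(7,8) unfolding modulus_of_continuity_def by blast+
  have near: "\<exists>z\<in>F1 x2 \<inter> F2 x2. dist y z \<le> ?\<omega> (dist x1 x2) + \<epsilon>"
    if \<epsilon>: "0 < \<epsilon>" and y: "y \<in> F1 x1 \<inter> F2 x1" for x1 x2 y \<epsilon>
  proof -
    \<comment> \<open>Enlarging both radii by \<open>\<delta>\<close> increases the bound by \<open>\<delta> + 2 * \<alpha> * \<delta> = \<epsilon>\<close>.\<close>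
    define \<delta> where "\<delta> = \<epsilon> / (1 + 2 * \<alpha>)"
    define r1 where "r1 = \<omega>1 (dist x1 x2) + \<delta>"
    define r2 where "r2 = \<omega>2 (dist x1 x2) + \<delta>"
    have "\<delta> * (1 + 2 * \<alpha>) = \<epsilon>"
      using assms(12) by (simp add: \<delta>_def)
    moreover have "0 < \<delta>"
      using \<epsilon> assms(12) by (simp add: \<delta>_def)
    ultimately have \<delta>: "0 < \<delta>" "\<delta> + 2 * \<alpha> * \<delta> = \<epsilon>"
      by (simp_all add: algebra_simps)
    obtain f1 where f1: "f1 \<in> F1 x2" "dist y f1 \<le> r1"
      using point_near_if_hausdorff_dist_less[OF h(1)[of x1 x2], of r1 y] \<omega>(1) \<delta>(1) y
      by (auto simp: r1_def)
    obtain f2 where f2: "f2 \<in> F2 x2" "dist y f2 \<le> r2"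
      using point_near_if_hausdorff_dist_less[OF h(2)[of x1 x2], of r2 y] \<omega>(2) \<delta>(1) y
      by (auto simp: r2_def)
    have "min (ediam (F1 x2)) (ediam (F2 x2)) \<le> ennreal (\<alpha> * \<gamma> x2)"
      using assms(9)[of x2] assms(14)[of x2] by simp
    moreover have "0 < r1 + r2"
      using \<omega>(1,2)[of "dist x1 x2"] \<delta>(1) by (simp add: r1_def r2_def)
    ultimately have "\<exists>z\<in>F1 x2 \<inter> F2 x2. dist y z \<le> max r1 r2 + \<alpha> * (r1 + r2)"
      using assms(3,6,11,12,13) f1 f2 by (intro intersection_point_near) auto
    moreover have "max r1 r2 + \<alpha> * (r1 + r2) = ?\<omega> (dist x1 x2) + \<epsilon>"
      unfolding \<delta>(2)[symmetric] r1_def r2_def by (simp add: max_def algebra_simps)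
    ultimately show ?thesis
      by simp
  qed
  have nonneg: "0 \<le> ?\<omega> t" if "0 \<le> t" for t
    using \<omega>(1,2)[OF that] assms(12) by simp
  have "hausdorff_dist (F1 x1 \<inter> F2 x1) (F1 x2 \<inter> F2 x2) \<le> ennreal (?\<omega> (dist x1 x2))" for x1 x2
  proof (rule ennreal_le_epsilon)
    fix \<epsilon> :: real
    assume "0 < \<epsilon>"
    then have "hausdorff_dist (F1 x1 \<inter> F2 x1) (F1 x2 \<inter> F2 x2) \<le> ennreal (?\<omega> (dist x1 x2) + \<epsilon>)"
      using near[of \<epsilon> _ x1 x2] near[of \<epsilon> _ x2 x1] nonneg[of "dist x1 x2"]
      by (intro hausdorff_dist_leI) (auto simp: dist_commute[of x2 x1])
    also have "\<dots> = ennreal (?\<omega> (dist x1 x2)) + ennreal \<epsilon>"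
      using nonneg[of "dist x1 x2"] \<open>0 < \<epsilon>\<close> by (intro ennreal_plus) auto
    finally show "hausdorff_dist (F1 x1 \<inter> F2 x1) (F1 x2 \<inter> F2 x2)
        \<le> ennreal (?\<omega> (dist x1 x2)) + ennreal \<epsilon>" .
  qed
  moreover have "(?\<omega> \<longlongrightarrow> 0) (at_right 0)"
    using tendsto_add[OF tendsto_max[OF \<omega>(3,4)]
      tendsto_mult_left[OF tendsto_add[OF \<omega>(3,4)], of \<alpha>]] by simp
  ultimately show "modulus_of_continuity ?\<omega> (\<lambda>x. F1 x \<inter> F2 x)"
    unfolding modulus_of_continuity_def using nonneg by blast
qed

end
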